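(* Let $\kappa$ be any ordinal of cardinality $\mathfrak{c}$. Then there exists a well-ordered increasing chain of order type $\kappa$ of prime $z$-filters on $\mathbb{R}$.
   Context: $\mathfrak{c}=2^{\aleph_0}$. A well-ordered increasing chain of order type $\kappa$ is a family $(\mathcal{Q}_\alpha:\alpha\in\kappa)$ with $\mathcal{Q}_\alpha\subsetneq\mathcal{Q}_\beta$ whenever $\alpha<\beta$ in $\kappa$. $\mathbf{Z}(f)=f^{-1}(0)$ and $\mathbf{Z}[\mathbb{R}]=\{\mathbf{Z}(f):f\in C(\mathbb{R})\}$, where $C(\mathbb{R})$ is the algebra of continuous functions on $\mathbb{R}$. A $z$-filter on $\mathbb{R}$ is a non-empty proper subset of $\mathbf{Z}[\mathbb{R}]$ closed under finite intersections and under supersets belonging to $\mathbf{Z}[\mathbb{R}]$. A $z$-filter $\mathcal{P}$ is prime if $Z_1\cup Z_2\notin\mathcal{P}$ whenever $Z_1,Z_2\in\mathbf{Z}[\mathbb{R}]\setminus\mathcal{P}$. *)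

theory Defs
  imports Complex_Main "HOL-Library.Equipollence"
begin

definition zero_set :: "(real \<Rightarrow> real) \<Rightarrow> real set" where
  "zero_set f = f -` {0}"

definition zero_sets :: "real set set" where
  "zero_sets = {zero_set f | f. continuous_on UNIV f}"

definition z_filter :: "real set set \<Rightarrow> bool" where
  "z_filter P \<longleftrightarrow>
     P \<noteq> {} \<and> P \<subset> zero_sets \<and>
     (\<forall>A\<in>P. \<forall>B\<in>P. A \<inter> B \<in> P) \<and>
     (\<forall>A\<in>P. \<forall>B\<in>zero_sets. A \<subseteq> B \<longrightarrow> B \<in> P)"

definition prime_z_filter :: "real set set \<Rightarrow> bool" where
  "prime_z_filter P \<longleftrightarrow>
     z_filter P \<and>
     (\<forall>Z1\<in>zero_sets - P. \<forall>Z2\<in>zero_sets - P. Z1 \<union> Z2 \<notin> P)"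

(* An ordinal is represented by a reflexive well-order r on the set Field r. *)
definition well_ordered_increasing_chain :: "'a rel \<Rightarrow> ('a \<Rightarrow> 'b set) \<Rightarrow> bool" where
  "well_ordered_increasing_chain r Q \<longleftrightarrow>
     Well_order r \<and>
     (\<forall>\<alpha>\<in>Field r. \<forall>\<beta>\<in>Field r. (\<alpha>, \<beta>) \<in> r \<and> \<alpha> \<noteq> \<beta> \<longrightarrow> Q \<alpha> \<subset> Q \<beta>)"

end

(* Zero sets of the real line are exactly the closed sets, and the closed sets Z for which
   "f x is in Z for U-almost all x" form a prime z-filter for every ultrafilter U.  Take an
   almost disjoint family A_X, X ranging over the sets of naturals, and the closed set Z_X of
   limits of the numbers ternary T (base 3 digits 0 and 1) with T finite and disjoint from A_X.
   For X_1, ..., X_n let k_i run along A_(X_i) modulo a free ultrafilter; the iterated limit,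
   with k_n outermost, of the condition ternary {k_j, ..., k_n} : Z gives a prime z-filter P_j.
   Letting the innermost k_j go to infinity shows P_j <= P_(j+1), and Z_(X_j) is in P_(j+1) but
   not in P_j.  So every finite suborder of kappa is realised by a chain whose strictness is
   witnessed by sets Z_X that do not depend on the suborder, and an ultraproduct over the finite
   suborders yields the whole chain. *)

theory Submission
  imports Defs "HOL-Analysis.Elementary_Metric_Spaces" "HOL-Library.Nat_Bijection"
begin

section \<open>Zero sets of the real line\<close>

lemma zero_sets_eq_closed: "zero_sets = {Z. closed Z}"
proof (intro set_eqI iffI)
  fix Z assume "Z \<in> zero_sets"
  then obtain f :: "real \<Rightarrow> real" where "Z = f -` {0}" "continuous_on UNIV f"
    by (auto simp: zero_sets_def zero_set_def)
  then show "Z \<in> {Z. closed Z}"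
    by (simp add: continuous_closed_vimage continuous_on_eq_continuous_at)
next
  fix Z :: "real set" assume "Z \<in> {Z. closed Z}"
  then have Z: "closed Z" by simp
  show "Z \<in> zero_sets"
  proof (cases "Z = {}")
    case True
    \<comment> \<open>The distance \<open>infdist x {}\<close> is 0 by convention, so the empty set
      gets a function of its own.\<close>
    then have "Z = zero_set (\<lambda>_. 1)" by (simp add: zero_set_def)
    then show ?thesis unfolding zero_sets_def using continuous_on_const by blast
  next
    case False
    then have "Z = zero_set (\<lambda>x. infdist x Z)"
      using in_closed_iff_infdist_zero[OF Z False] by (auto simp: zero_set_def)
    moreover have "continuous_on UNIV (\<lambda>x. infdist x Z)"
      by (intro continuous_intros)
    ultimately show ?thesis unfolding zero_sets_def by blast
  qed
qed

section \<open>Ultrafilters as Boolean homomorphisms\<close>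

text \<open>An ultrafilter is encoded as a quantifier "for almost all x". Iterated limits then
  become nested quantifiers, and images under maps become compositions.\<close>

definition ultra :: "(('a \<Rightarrow> bool) \<Rightarrow> bool) \<Rightarrow> bool" where
  "ultra U \<longleftrightarrow> (\<forall>P Q. U (\<lambda>x. P x \<and> Q x) \<longleftrightarrow> U P \<and> U Q) \<and> (\<forall>P. U (\<lambda>x. \<not> P x) \<longleftrightarrow> \<not> U P)"

lemma ultra_conj: "ultra U \<Longrightarrow> U (\<lambda>x. P x \<and> Q x) \<longleftrightarrow> U P \<and> U Q"
  and ultra_not: "ultra U \<Longrightarrow> U (\<lambda>x. \<not> P x) \<longleftrightarrow> \<not> U P"
  by (simp_all add: ultra_def)

lemma ultra_disj: "ultra U \<Longrightarrow> U (\<lambda>x. P x \<or> Q x) \<longleftrightarrow> U P \<or> U Q"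
  using ultra_not[of U "\<lambda>x. \<not> P x \<and> \<not> Q x"] ultra_conj[of U "\<lambda>x. \<not> P x" "\<lambda>x. \<not> Q x"]
  by (simp add: ultra_not)

lemma ultra_False: "ultra U \<Longrightarrow> \<not> U (\<lambda>x. False)"
  using ultra_conj[of U "\<lambda>_. False" "\<lambda>_. True"] ultra_not[of U "\<lambda>_. False"] by auto

lemma ultra_mono:
  assumes "ultra U" "U P" "\<And>x. P x \<Longrightarrow> Q x"
  shows "U Q"
proof -
  have "(\<lambda>x. P x \<and> Q x) = P" using assms(3) by auto
  then show ?thesis using ultra_conj[OF assms(1), of P Q] assms(2) by simp
qed

lemma ultra_all: "ultra U \<Longrightarrow> (\<And>x. P x) \<Longrightarrow> U P"
  using ultra_False[of U] ultra_not[of U P] by simp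

lemma ultra_bind: "ultra U \<Longrightarrow> (\<And>x. ultra (V x)) \<Longrightarrow> ultra (\<lambda>P. U (\<lambda>x. V x P))"
  by (simp add: ultra_def)

lemma ultra_map: "ultra U \<Longrightarrow> ultra (\<lambda>P. U (\<lambda>x. P (f x)))"
  by (simp add: ultra_def)

lemma ultra_point: "ultra (\<lambda>P. P x)"
  by (simp add: ultra_def)

text \<open>In this order finer filters are smaller, so Zorn's lemma is applied to the reversed
  order and yields a minimal proper filter below \<open>F\<close>.\<close>

lemma ultra_extends_filter:
  assumes "F \<noteq> bot"
  obtains U where "ultra U" "\<And>P. eventually P F \<Longrightarrow> U P"
proof -
  define A where "A = {G. G \<le> F \<and> G \<noteq> bot}"
  have "\<exists>M\<in>A. \<forall>G\<in>A. M \<ge> G \<longrightarrow> G = M"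
  proof (rule predicate_Zorn)
    show "partial_order_on A (relation_of (\<ge>) A)"
      by (rule partial_order_on_relation_ofI) auto
  next
    fix C assume "C \<in> Chains (relation_of (\<ge>) A)"
    then have C: "C \<subseteq> A" and tot: "\<And>G H. G \<in> C \<Longrightarrow> H \<in> C \<Longrightarrow> G \<le> H \<or> H \<le> G"
      by (auto simp: Chains_def relation_of_def)
    show "\<exists>L\<in>A. \<forall>G\<in>C. G \<ge> L"
    proof (cases "C = {}")
      case True
      then show ?thesis using assms by (auto simp: A_def)
    next
      case False
      \<comment> \<open>A chain is directed, so an event of the infimum is already an event of a
        single member; hence the infimum stays proper.\<close>
      have ev: "eventually P (Inf C) \<longleftrightarrow> (\<exists>G\<in>C. eventually P G)" for P
        by (rule eventually_Inf_base[OF False]) (metis inf.orderE inf.commute tot)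
      have "Inf C \<noteq> bot"
        using C by (auto simp: ev A_def trivial_limit_def)
      moreover have "Inf C \<le> F"
        using C False by (auto simp: A_def intro: Inf_lower2)
      ultimately show ?thesis by (auto simp: A_def intro!: bexI[of _ "Inf C"] Inf_lower)
    qed
  qed
  then obtain M where M: "M \<le> F" "M \<noteq> bot" and max: "\<And>G. G \<le> M \<Longrightarrow> G \<noteq> bot \<Longrightarrow> G = M"
    using order_trans unfolding A_def by blast
  \<comment> \<open>If \<open>P\<close> is not eventual, restricting \<open>M\<close> to the
    complement of \<open>P\<close> leaves it proper, so by minimality the restriction changes
    nothing.\<close>
  have "eventually (\<lambda>x. \<not> P x) M" if "\<not> eventually P M" for P
  proof -
    have "inf M (principal {x. \<not> P x}) \<noteq> bot"
      using that by (auto simp: trivial_limit_def eventually_inf_principal)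
    then have "inf M (principal {x. \<not> P x}) = M" by (intro max) auto
    then show ?thesis
      using eventually_inf_principal[of "\<lambda>x. \<not> P x" M "{x. \<not> P x}"] by simp
  qed
  then have "ultra (\<lambda>P. eventually P M)"
    unfolding ultra_def using M(2)
    by (auto simp: eventually_conj_iff trivial_limit_def dest: eventually_elim2 eventually_conj)
  moreover have "eventually P M" if "eventually P F" for P
    using M(1) that by (simp add: le_filter_def)
  ultimately show ?thesis using that by blast
qed

text \<open>This is the trace on the closed sets of the image of \<open>U\<close> under
  \<open>f\<close>. Primeness is inherited because an ultrafilter distributes over
  disjunctions.\<close>

lemma ultra_prime_z_filter:
  assumes "ultra U"
  shows "prime_z_filter {Z \<in> zero_sets. U (\<lambda>x. f x \<in> Z)}" (is "prime_z_filter ?P")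
proof -
  have "UNIV \<in> ?P" using ultra_all[OF assms] by (simp add: zero_sets_eq_closed)
  moreover have "{} \<in> zero_sets - ?P" using ultra_False[OF assms] by (simp add: zero_sets_eq_closed)
  moreover have "A \<inter> B \<in> ?P" if "A \<in> ?P" "B \<in> ?P" for A B
    using that by (auto simp: zero_sets_eq_closed ultra_conj[OF assms])
  moreover have "B \<in> ?P" if "A \<in> ?P" "B \<in> zero_sets" "A \<subseteq> B" for A B
    using that ultra_mono[OF assms, of "\<lambda>x. f x \<in> A" "\<lambda>x. f x \<in> B"] by auto
  moreover have "Z1 \<union> Z2 \<notin> ?P" if "Z1 \<in> zero_sets - ?P" "Z2 \<in> zero_sets - ?P" for Z1 Z2
    using that by (simp add: ultra_disj[OF assms])
  ultimately show ?thesis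
    unfolding prime_z_filter_def z_filter_def by blast
qed

section \<open>Finite sets of naturals as real numbers\<close>

text \<open>With digits 0 and 1 in base 3, everything after digit m weighs at most half of digit m.
  An infinite set gets the default value 0, so the later arguments keep track of finiteness.\<close>

definition ternary :: "nat set \<Rightarrow> real" where
  "ternary S = (\<Sum>i\<in>S. (1/3) ^ i)"

lemma ternary_mono: "finite T \<Longrightarrow> S \<subseteq> T \<Longrightarrow> ternary S \<le> ternary T"
  unfolding ternary_def by (rule sum_mono2) auto

lemma ternary_tail:
  assumes "finite S" "\<And>i. i \<in> S \<Longrightarrow> m < i"
  shows "ternary S \<le> (1/3) ^ m / 2"
proof -
  have sum: "ternary {m<..m + d} = ((1/3) ^ m - (1/3) ^ (m + d)) / 2" for d
  proof (induction d)
    case 0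
    then show ?case by (simp add: ternary_def)
  next
    case (Suc d)
    have "{m<..m + Suc d} = insert (m + Suc d) {m<..m + d}" by auto
    then have "ternary {m<..m + Suc d} = (1/3) ^ (m + Suc d) + ternary {m<..m + d}"
      by (simp add: ternary_def)
    then show ?case using Suc by (simp add: power_add field_simps)
  qed
  obtain d where "\<forall>i\<in>S. i \<le> d" using assms(1) finite_nat_set_iff_bounded_le by blast
  then have "S \<subseteq> {m<..m + d}" using assms(2) by fastforce
  then have "ternary S \<le> ternary {m<..m + d}" by (intro ternary_mono) auto
  also have "\<dots> \<le> (1/3) ^ m / 2" by (simp add: sum)
  finally show ?thesis .
qed

text \<open>The least position m in which the sets differ decides, since its digit outweighs all
  later ones, and m is at most k. The bound depends on k alone, so it is uniform in
  \<open>T\<close>.\<close>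

lemma ternary_separated:
  assumes "finite S" "finite T" "k \<in> S" "k \<notin> T"
  shows "(1/3) ^ k / 2 \<le> \<bar>ternary S - ternary T\<bar>"
proof -
  have diff: "ternary S - ternary T = ternary (S - T) - ternary (T - S)"
    unfolding ternary_def
    using sum.Int_Diff[OF assms(1), of "\<lambda>i. (1/3 :: real) ^ i" T]
      sum.Int_Diff[OF assms(2), of "\<lambda>i. (1/3 :: real) ^ i" S]
    unfolding Int_commute[of T S] by linarith
  define m where "m = Min ((S - T) \<union> (T - S))"
  have fin: "finite ((S - T) \<union> (T - S))" using assms by simp
  have m: "m \<in> (S - T) \<union> (T - S)" "m \<le> k"
    unfolding m_def using fin assms(3,4) by (auto intro!: Min_in[OF fin] Min_le[OF fin] simp del: Un_iff)
  have least: "m \<le> i" if "i \<in> (S - T) \<union> (T - S)" for i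
    unfolding m_def using fin that by (rule Min_le)
  have first: "(1/3) ^ m / 2 \<le> ternary A - ternary B"
    if "finite A" "finite B" "m \<in> A" "\<And>i. i \<in> B \<Longrightarrow> m < i" for A B
  proof -
    have "(1/3) ^ m \<le> ternary A" using ternary_mono[of A "{m}"] that by (simp add: ternary_def)
    moreover have "ternary B \<le> (1/3) ^ m / 2" using that by (intro ternary_tail) auto
    ultimately show ?thesis by simp
  qed
  have "(1/3) ^ m / 2 \<le> \<bar>ternary S - ternary T\<bar>"
  proof (cases "m \<in> S")
    case True
    then have "(1/3) ^ m / 2 \<le> ternary (S - T) - ternary (T - S)"
      using assms m least by (intro first) (auto simp: order_le_less)
    then show ?thesis using diff by linarith
  next
    case False
    then have "(1/3) ^ m / 2 \<le> ternary (T - S) - ternary (S - T)"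
      using assms m least by (intro first) (auto simp: order_le_less)
    then show ?thesis using diff by linarith
  qed
  moreover have "(1/3 :: real) ^ k \<le> (1/3) ^ m" using m(2) by (intro power_decreasing) auto
  ultimately show ?thesis by linarith
qed

lemma ternary_insert_tendsto:
  assumes "finite S"
  shows "(\<lambda>k. ternary (insert k S)) \<longlonglongrightarrow> ternary S"
proof -
  have "eventually (\<lambda>k. k \<notin> S) sequentially"
    using assms by (metis eventually_sequentially finite_nat_set_iff_bounded not_le)
  then have "eventually (\<lambda>k. (1/3) ^ k + ternary S = ternary (insert k S)) sequentially"
    by eventually_elim (simp add: ternary_def assms)
  moreover have "(\<lambda>k. (1/3) ^ k + ternary S) \<longlonglongrightarrow> 0 + ternary S"
    by (intro tendsto_intros LIMSEQ_power_zero) auto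
  ultimately show ?thesis using Lim_transform_eventually by fastforce
qed

section \<open>An almost disjoint family and its closed sets\<close>

text \<open>These are the codes of the nodes on the path of \<open>X\<close> through the binary
  tree; distinct paths share only finitely many nodes. Recording the level n makes the n-th code at
  least n.\<close>

definition branch :: "nat set \<Rightarrow> nat \<Rightarrow> nat" where
  "branch X n = prod_encode (n, set_encode (X \<inter> {..<n}))"

lemma branch_at_top: "filterlim (branch X) at_top sequentially"
  by (rule filterlim_at_top_mono[OF filterlim_ident])
    (simp add: branch_def le_prod_encode_1)

lemma branch_almost_disjoint:
  assumes "X \<noteq> Y"
  shows "eventually (\<lambda>n. branch X n \<notin> range (branch Y)) sequentially"
proof -
  obtain m where m: "m \<in> X \<longleftrightarrow> m \<notin> Y" using assms by blast
  have "branch X n \<noteq> branch Y n'" if "m < n" for n n'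
  proof
    assume "branch X n = branch Y n'"
    then have "X \<inter> {..<n} = Y \<inter> {..<n}"
      by (auto simp: branch_def set_encode_eq)
    then show False using m that by blast
  qed
  then show ?thesis
    unfolding eventually_at_top_dense by blast
qed

definition avoiding :: "nat set \<Rightarrow> real set" where
  "avoiding A = closure (ternary ` {T. finite T \<and> T \<inter> A = {}})"

lemma avoiding_zero_set: "avoiding A \<in> zero_sets"
  by (simp add: zero_sets_eq_closed avoiding_def)

text \<open>The closure adds no value of a finite set: if k lies in \<open>S\<close> and in
  \<open>A\<close>, then every \<open>T\<close> disjoint from \<open>A\<close> omits k, and
  \<open>ternary_separated\<close> keeps \<open>ternary T\<close> at a fixed distance from
  \<open>ternary S\<close>.\<close>

lemma ternary_in_avoiding_iff:
  assumes "finite S"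
  shows "ternary S \<in> avoiding A \<longleftrightarrow> S \<inter> A = {}"
proof
  assume cl: "ternary S \<in> avoiding A"
  show "S \<inter> A = {}"
  proof (rule ccontr)
    assume "S \<inter> A \<noteq> {}"
    then obtain k where k: "k \<in> S" "k \<in> A" by blast
    have "\<exists>y\<in>ternary ` {T. finite T \<and> T \<inter> A = {}}. dist y (ternary S) < (1/3) ^ k / 2"
      using cl[unfolded avoiding_def closure_approachable]
      by (meson half_gt_zero zero_less_divide_1_iff zero_less_numeral zero_less_power)
    then obtain T where "finite T" "T \<inter> A = {}" "dist (ternary T) (ternary S) < (1/3) ^ k / 2"
      by blast
    then show False
      using ternary_separated[OF assms, of T k] k by (auto simp: dist_real_def abs_minus_commute)
  qed
next
  assume "S \<inter> A = {}"
  then show "ternary S \<in> avoiding A"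
    unfolding avoiding_def using assms by (intro subsetD[OF closure_subset]) simp
qed

section \<open>Iterated limits\<close>

text \<open>The last set of the list is the outermost limit, so that prepending a set passes to
  points near the earlier ones.\<close>

fun iter_limit :: "((nat \<Rightarrow> bool) \<Rightarrow> bool) \<Rightarrow> nat set list \<Rightarrow> (nat set \<Rightarrow> bool) \<Rightarrow> bool" where
  "iter_limit U [] P = P {}"
| "iter_limit U (X # Xs) P = iter_limit U Xs (\<lambda>S. U (\<lambda>n. P (insert (branch X n) S)))"

locale free_ultra =
  fixes U :: "(nat \<Rightarrow> bool) \<Rightarrow> bool"
  assumes ultra: "ultra U"
    and eventually: "eventually P sequentially \<Longrightarrow> U P"
begin

lemma ultra_iter_limit: "ultra (iter_limit U Xs)"
proof (induction Xs)
  case Nil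
  show ?case using ultra_point[of "{}"] by (simp add: ultra_def)
next
  case (Cons X Xs)
  then have "ultra (\<lambda>P. iter_limit U Xs (\<lambda>S. U (\<lambda>n. P (insert (branch X n) S))))"
    using ultra_map[OF ultra]
    by (rule ultra_bind[where V = "\<lambda>S P. U (\<lambda>n. P (insert (branch X n) S))"])
  then show ?case by (simp add: ultra_def)
qed

lemma iter_limit_ConsI:
  assumes "iter_limit U Xs P" "\<And>S. P S \<Longrightarrow> U (\<lambda>n. Q (insert (branch X n) S))"
  shows "iter_limit U (X # Xs) Q"
  unfolding iter_limit.simps
  by (rule ultra_mono[OF ultra_iter_limit, OF assms(1)]) (rule assms(2))

lemma iter_limit_finite: "iter_limit U Xs finite"
proof (induction Xs)
  case (Cons X Xs)
  then show ?case
  proof (rule iter_limit_ConsI)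
    show "U (\<lambda>n. finite (insert (branch X n) S))" if "finite S" for S
      by (rule ultra_all[OF ultra]) (use that in simp)
  qed
qed simp

lemma iter_limit_cong_finite:
  assumes "iter_limit U Xs P" "\<And>S. finite S \<Longrightarrow> P S \<Longrightarrow> Q S"
  shows "iter_limit U Xs Q"
proof (rule ultra_mono[OF ultra_iter_limit])
  show "iter_limit U Xs (\<lambda>S. finite S \<and> P S)"
    using ultra_conj[OF ultra_iter_limit] iter_limit_finite assms(1) by blast
qed (use assms(2) in blast)

text \<open>The inserted digit moves off to infinity, so the points converge to
  \<open>ternary S\<close>; were this outside \<open>Z\<close>, almost all of them would be as
  well.\<close>

lemma limit_in_closed:
  assumes "closed Z" "finite S" "U (\<lambda>n. ternary (insert (branch X n) S) \<in> Z)"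
  shows "ternary S \<in> Z"
proof (rule ccontr)
  assume "ternary S \<notin> Z"
  moreover have "(\<lambda>n. ternary (insert (branch X n) S)) \<longlonglongrightarrow> ternary S"
    by (rule filterlim_compose[OF ternary_insert_tendsto[OF assms(2)] branch_at_top])
  ultimately have "eventually (\<lambda>n. ternary (insert (branch X n) S) \<in> - Z) sequentially"
    using assms(1) by (intro topological_tendstoD) auto
  then have "U (\<lambda>n. \<not> ternary (insert (branch X n) S) \<in> Z)"
    using eventually by fastforce
  then show False using assms(3) ultra_not[OF ultra] by blast
qed

text \<open>The sets in \<open>Xs\<close> belong to the innermost limits, which
  \<open>limit_in_closed\<close> removes one at a time. This is the source of the inclusions in the
  chain.\<close>

lemma iter_limit_append:
  assumes "closed Z" "iter_limit U (Xs @ Ys) (\<lambda>S. ternary S \<in> Z)"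
  shows "iter_limit U Ys (\<lambda>S. ternary S \<in> Z)"
  using assms(2)
proof (induction Xs)
  case (Cons X Xs)
  then have "iter_limit U (Xs @ Ys) (\<lambda>S. U (\<lambda>n. ternary (insert (branch X n) S) \<in> Z))"
    by simp
  then have "iter_limit U (Xs @ Ys) (\<lambda>S. ternary S \<in> Z)"
    by (rule iter_limit_cong_finite) (rule limit_in_closed[OF assms(1)])
  then show ?case by (rule Cons.IH)
qed simp

text \<open>Each inserted point comes from a path other than that of \<open>Y\<close>, hence almost
  always misses the nodes of \<open>Y\<close>.\<close>

lemma iter_limit_disjoint:
  assumes "Y \<notin> set Xs"
  shows "iter_limit U Xs (\<lambda>S. S \<inter> range (branch Y) = {})"
  using assms
proof (induction Xs)
  case (Cons X Xs)
  have "U (\<lambda>n. branch X n \<notin> range (branch Y))"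
    by (rule eventually[OF branch_almost_disjoint]) (use Cons.prems in auto)
  then have "U (\<lambda>n. insert (branch X n) S \<inter> range (branch Y) = {})"
    if "S \<inter> range (branch Y) = {}" for S
    by (rule ultra_mono[OF ultra]) (use that in auto)
  moreover have "iter_limit U Xs (\<lambda>S. S \<inter> range (branch Y) = {})"
    using Cons by simp
  ultimately show ?case by (intro iter_limit_ConsI)
qed simp

lemma iter_limit_meets:
  assumes "Y \<in> set Xs"
  shows "iter_limit U Xs (\<lambda>S. S \<inter> range (branch Y) \<noteq> {})"
  using assms
proof (induction Xs)
  case (Cons X Xs)
  show ?case
  proof (cases "Y = X")
    case True
    then show ?thesis
      unfolding iter_limit.simps
      by (intro ultra_all[OF ultra_iter_limit]) (rule ultra_all[OF ultra], auto)
  next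
    case False
    have "U (\<lambda>n. insert (branch X n) S \<inter> range (branch Y) \<noteq> {})"
      if "S \<inter> range (branch Y) \<noteq> {}" for S
      by (rule ultra_all[OF ultra]) (use that in auto)
    moreover have "iter_limit U Xs (\<lambda>S. S \<inter> range (branch Y) \<noteq> {})"
      using Cons False by simp
    ultimately show ?thesis by (intro iter_limit_ConsI)
  qed
qed simp

text \<open>The closed set that tests for \<open>Y\<close> is the same for every list; this
  uniformity lets strictness survive the ultraproduct.\<close>

lemma iter_limit_avoiding_iff:
  "iter_limit U Xs (\<lambda>S. ternary S \<in> avoiding (range (branch Y))) \<longleftrightarrow> Y \<notin> set Xs"
proof (cases "Y \<in> set Xs")
  case True
  then have "iter_limit U Xs (\<lambda>S. \<not> ternary S \<in> avoiding (range (branch Y)))"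
    by (rule iter_limit_cong_finite[OF iter_limit_meets]) (simp add: ternary_in_avoiding_iff)
  then show ?thesis using True ultra_not[OF ultra_iter_limit] by auto
next
  case False
  then have "iter_limit U Xs (\<lambda>S. ternary S \<in> avoiding (range (branch Y)))"
    by (rule iter_limit_cong_finite[OF iter_limit_disjoint]) (simp add: ternary_in_avoiding_iff)
  then show ?thesis using False by simp
qed

end

section \<open>Finite subsets of a well-order\<close>

lemma finite_sorted_list:
  assumes "Well_order r" "finite F" "F \<subseteq> Field r"
  shows "\<exists>xs. sorted_wrt (\<lambda>x y. (x, y) \<in> r) xs \<and> set xs = F"
  using assms(2,3)
proof (induction F rule: finite_psubset_induct)
  case (psubset F)
  show ?case
  proof (cases "F = {}")
    case False
    interpret wo_rel r using assms(1) by (simp add: wo_rel_def)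
    have min: "minim F \<in> F" "\<And>y. y \<in> F \<Longrightarrow> (minim F, y) \<in> r"
      using minim_in minim_least psubset.prems False by auto
    then obtain xs where xs: "sorted_wrt (\<lambda>x y. (x, y) \<in> r) xs" "set xs = F - {minim F}"
      using psubset.IH[of "F - {minim F}"] psubset.prems by blast
    then have "sorted_wrt (\<lambda>x y. (x, y) \<in> r) (minim F # xs)" "set (minim F # xs) = F"
      using min by auto
    then show ?thesis by blast
  qed auto
qed

text \<open>In a sorted list the entries above b form a final segment, and by transitivity they are
  also above a. The remainder \<open>zs\<close> is the block of inner limits to be dropped.\<close>

lemma filter_above_suffix:
  assumes "trans r" "sorted_wrt (\<lambda>x y. (x, y) \<in> r) xs" "(a, b) \<in> r"
  shows "\<exists>zs. filter (\<lambda>x. (a, x) \<in> r) xs = zs @ filter (\<lambda>x. (b, x) \<in> r) xs"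
  using assms(2)
proof (induction xs)
  case (Cons x xs)
  show ?case
  proof (cases "(b, x) \<in> r")
    case True
    then have "(b, y) \<in> r" if "y \<in> set (x # xs)" for y
      using Cons.prems that by (auto intro: transD[OF assms(1)])
    moreover from this have "(a, y) \<in> r" if "y \<in> set (x # xs)" for y
      using that transD[OF assms(1) assms(3)] by blast
    ultimately have "filter (\<lambda>x. (b, x) \<in> r) (x # xs) = x # xs"
      "filter (\<lambda>x. (a, x) \<in> r) (x # xs) = x # xs"
      by (intro filter_True ballI; blast)+
    then show ?thesis by simp
  next
    case False
    obtain zs where "filter (\<lambda>x. (a, x) \<in> r) xs = zs @ filter (\<lambda>x. (b, x) \<in> r) xs"
      using Cons by auto
    then have "filter (\<lambda>x. (a, x) \<in> r) (x # xs)
        = (if (a, x) \<in> r then x # zs else zs) @ filter (\<lambda>x. (b, x) \<in> r) (x # xs)"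
      using False by simp
    then show ?thesis by blast
  qed
qed simp

section \<open>The ultraproduct over the finite suborders\<close>

theorem corollary5p8:
  fixes \<kappa> :: "'a rel"
  assumes "Well_order \<kappa>"
    and "Field \<kappa> \<approx> (UNIV :: nat set set)"
  shows "\<exists>Q :: 'a \<Rightarrow> real set set.
           well_ordered_increasing_chain \<kappa> Q \<and> (\<forall>\<alpha>\<in>Field \<kappa>. prime_z_filter (Q \<alpha>))"
proof -
  have trans: "trans \<kappa>" and anti: "antisym \<kappa>" and refl: "\<And>\<alpha>. \<alpha> \<in> Field \<kappa> \<Longrightarrow> (\<alpha>, \<alpha>) \<in> \<kappa>"
    using assms(1)
    by (auto simp: well_order_on_def linear_order_on_def partial_order_on_def preorder_on_def
        dest: refl_onD)
  \<comment> \<open>Each element of the order is labelled by its own member of the almost disjoint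
    family.\<close>
  obtain e :: "'a \<Rightarrow> nat set" where e: "inj_on e (Field \<kappa>)"
    using assms(2) by (auto simp: eqpoll_def bij_betw_def)
  obtain U :: "(nat \<Rightarrow> bool) \<Rightarrow> bool" where "ultra U" "\<And>P. eventually P sequentially \<Longrightarrow> U P"
    using ultra_extends_filter[OF sequentially_bot] by blast
  then interpret free_ultra U by unfold_locales
  \<comment> \<open>Every fixed element of the order lies in \<open>W\<close>-almost every finite
    suborder.\<close>
  obtain W :: "('a set \<Rightarrow> bool) \<Rightarrow> bool"
    where W: "ultra W" "\<And>P. eventually P (finite_subsets_at_top (Field \<kappa>)) \<Longrightarrow> W P"
    using ultra_extends_filter[OF finite_subsets_at_top_neq_bot] by blast
  obtain sorted where sorted: "\<And>F. finite F \<Longrightarrow> F \<subseteq> Field \<kappa> \<Longrightarrow>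
      sorted_wrt (\<lambda>x y. (x, y) \<in> \<kappa>) (sorted F) \<and> set (sorted F) = F"
    using finite_sorted_list[OF assms(1)] by metis
  \<comment> \<open>The limits for \<alpha> run over the members of \<open>F\<close> from \<alpha>
    upwards, larger ones further out; \<alpha> itself, if in \<open>F\<close>, is innermost.\<close>
  define above where "above \<alpha> F = map e (filter (\<lambda>\<beta>. (\<alpha>, \<beta>) \<in> \<kappa>) (sorted F))" for \<alpha> F
  define V where "V \<alpha> P = W (\<lambda>F. iter_limit U (above \<alpha> F) P)" for \<alpha> P
  define Q where "Q \<alpha> = {Z \<in> zero_sets. V \<alpha> (\<lambda>S. ternary S \<in> Z)}" for \<alpha>
  have W_finite: "W P" if "\<And>F. finite F \<Longrightarrow> F \<subseteq> Field \<kappa> \<Longrightarrow> \<gamma> \<in> F \<Longrightarrow> P F" "\<gamma> \<in> Field \<kappa>" for P \<gamma>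
  proof (rule W(2))
    show "eventually P (finite_subsets_at_top (Field \<kappa>))"
      unfolding eventually_finite_subsets_at_top using that
      by (intro exI[of _ "{\<gamma>}"]) auto
  qed
  have "ultra (V \<alpha>)" for \<alpha>
    using ultra_bind[OF W(1) ultra_iter_limit] by (simp add: ultra_def V_def)
  then have prime: "prime_z_filter (Q \<alpha>)" for \<alpha>
    unfolding Q_def by (rule ultra_prime_z_filter)
  have "Q \<alpha> \<subset> Q \<beta>" if \<alpha>\<beta>: "\<alpha> \<in> Field \<kappa>" "\<beta> \<in> Field \<kappa>" "(\<alpha>, \<beta>) \<in> \<kappa>" "\<alpha> \<noteq> \<beta>" for \<alpha> \<beta>
  proof
    show "Q \<alpha> \<subseteq> Q \<beta>"
    proof
      fix Z assume "Z \<in> Q \<alpha>"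
      then have Z: "Z \<in> zero_sets" "closed Z"
        and lim: "W (\<lambda>F. iter_limit U (above \<alpha> F) (\<lambda>S. ternary S \<in> Z))"
        by (auto simp: Q_def V_def zero_sets_eq_closed)
      \<comment> \<open>The inclusion holds in each finite suborder separately, so it passes through
        \<open>W\<close> as an implication.\<close>
      have "W (\<lambda>F. iter_limit U (above \<alpha> F) (\<lambda>S. ternary S \<in> Z) \<longrightarrow>
          iter_limit U (above \<beta> F) (\<lambda>S. ternary S \<in> Z))"
      proof (rule W_finite[OF _ \<alpha>\<beta>(1)], intro impI)
        fix F assume F: "finite F" "F \<subseteq> Field \<kappa>"
          and "iter_limit U (above \<alpha> F) (\<lambda>S. ternary S \<in> Z)"
        moreover obtain zs where "above \<alpha> F = zs @ above \<beta> F"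
          using filter_above_suffix[OF trans _ \<alpha>\<beta>(3)] sorted[OF F]
          unfolding above_def by (metis map_append)
        ultimately show "iter_limit U (above \<beta> F) (\<lambda>S. ternary S \<in> Z)"
          using iter_limit_append[OF Z(2)] by metis
      qed
      with lim have "W (\<lambda>F. iter_limit U (above \<alpha> F) (\<lambda>S. ternary S \<in> Z) \<and>
          (iter_limit U (above \<alpha> F) (\<lambda>S. ternary S \<in> Z) \<longrightarrow>
          iter_limit U (above \<beta> F) (\<lambda>S. ternary S \<in> Z)))"
        by (simp only: ultra_conj[OF W(1)])
      then have "W (\<lambda>F. iter_limit U (above \<beta> F) (\<lambda>S. ternary S \<in> Z))"
        by (rule ultra_mono[OF W(1)]) blast
      then show "Z \<in> Q \<beta>"
        using Z(1) by (simp add: Q_def V_def)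
    qed
    \<comment> \<open>The label of \<alpha> occurs in the list for \<alpha> but not in the one for
      the strictly larger \<beta>, as soon as \<open>F\<close> contains \<alpha>. So this set enters
      the chain strictly between the two.\<close>
    let ?Z = "avoiding (range (branch (e \<alpha>)))"
    have e_above: "e \<alpha> \<in> set (above \<gamma> F) \<longleftrightarrow> (\<gamma>, \<alpha>) \<in> \<kappa>"
      if "finite F" "F \<subseteq> Field \<kappa>" "\<alpha> \<in> F" for \<gamma> F
    proof -
      have "e \<alpha> = e x \<longleftrightarrow> \<alpha> = x" if "x \<in> F" for x
        using inj_on_eq_iff[OF e] that \<open>\<alpha> \<in> F\<close> \<open>F \<subseteq> Field \<kappa>\<close> by blast
      then show ?thesis using sorted[OF that(1,2)] that(3) by (auto simp: above_def)
    qed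
    have "W (\<lambda>F. \<not> iter_limit U (above \<alpha> F) (\<lambda>S. ternary S \<in> ?Z))"
      by (rule W_finite[OF _ \<alpha>\<beta>(1)]) (simp add: iter_limit_avoiding_iff e_above refl \<alpha>\<beta>(1))
    then have "?Z \<notin> Q \<alpha>"
      by (simp add: Q_def V_def ultra_not[OF W(1)])
    moreover have "(\<beta>, \<alpha>) \<notin> \<kappa>" using anti \<alpha>\<beta> by (auto dest: antisymD)
    then have "W (\<lambda>F. iter_limit U (above \<beta> F) (\<lambda>S. ternary S \<in> ?Z))"
      by (intro W_finite[OF _ \<alpha>\<beta>(1)]) (simp add: iter_limit_avoiding_iff e_above)
    then have "?Z \<in> Q \<beta>"
      by (simp add: Q_def V_def avoiding_zero_set)
    ultimately show "Q \<alpha> \<noteq> Q \<beta>" by blast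
  qed
  then have "well_ordered_increasing_chain \<kappa> Q"
    using assms(1) by (simp add: well_ordered_increasing_chain_def)
  then show ?thesis using prime by blast
qed

end
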